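(* There is a deterministic comparison-based algorithm that computes $MAX_n^{\boxplus n}$ (equivalently $MIN_n^{\boxplus n}$) on inputs of length $2n-1$ using time $O(n\log n)$ and space $O(\log n)$ bits.
   Context: $MAX_n(a)$ (resp. $MIN_n(a)$) is the largest (resp. smallest) symbol of a length-$n$ string $a$ over a linearly ordered set. $MAX_n^{\boxplus n}(x)=(MAX_n(x_i\ldots x_{i+n-1}))_{i=1}^n$ for $x=x_1\ldots x_{2n-1}$, and similarly for $MIN$. Space excludes the read-only input and write-only output. *)

theory Defs
  imports
    Complex_Main
    "HOL-Library.Landau_Symbols"
    "HOL-Library.Log_Nat"
    "HOL-Library.Multiset"
begin

text \<open>
  The model is a deterministic random access machine with a read-only input array, a write-only
  output array and a working memory of natural numbers. A program can address the input symbols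
  by (0-based) index, but it can neither store a symbol nor test it for anything except the
  outcome of an order comparison with another symbol.

  In \<open>Compare a b l\<close> and \<open>Output p a\<close> the operands are memory cells that hold the
  indices involved.
\<close>

datatype instr =
    Const nat nat
  | Copy nat nat
  | Add nat nat nat
  | Sub nat nat nat
  | Half nat nat
  | Load nat nat
  | Store nat nat
  | Jump nat
  | JumpLess nat nat nat
  | Compare nat nat nat
  | Output nat nat
  | Halt

text \<open>
  \<open>written\<close> is the log of all writes to the output array, each a pair of an output index and a
  symbol, the latest first. No instruction reads it.
\<close>

record 'a config =
  pc :: nat
  mem :: "nat \<Rightarrow> nat"
  written :: "(nat \<times> 'a) list"

definition set_cell :: "nat \<Rightarrow> nat \<Rightarrow> 'a config \<Rightarrow> 'a config" where
  "set_cell a v c = c\<lparr>pc := Suc (pc c), mem := (mem c)(a := v)\<rparr>"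

definition branch :: "bool \<Rightarrow> nat \<Rightarrow> 'a config \<Rightarrow> 'a config" where
  "branch b l c = c\<lparr>pc := (if b then l else Suc (pc c))\<rparr>"

text \<open>
  \<open>None\<close> means that there is no successor configuration: the machine has halted, or it
  is stuck because of an input index out of range.
\<close>

fun exec :: "'a::linorder list \<Rightarrow> instr \<Rightarrow> 'a config \<Rightarrow> 'a config option" where
  "exec x (Const a k) c = Some (set_cell a k c)"
| "exec x (Copy a b) c = Some (set_cell a (mem c b) c)"
| "exec x (Add a b d) c = Some (set_cell a (mem c b + mem c d) c)"
| "exec x (Sub a b d) c = Some (set_cell a (mem c b - mem c d) c)"
| "exec x (Half a b) c = Some (set_cell a (mem c b div 2) c)"
| "exec x (Load a b) c = Some (set_cell a (mem c (mem c b)) c)"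
| "exec x (Store a b) c = Some (set_cell (mem c a) (mem c b) c)"
| "exec x (Jump l) c = Some (branch True l c)"
| "exec x (JumpLess a b l) c = Some (branch (mem c a < mem c b) l c)"
| "exec x (Compare a b l) c =
     (if mem c a < length x \<and> mem c b < length x
      then Some (branch (x ! mem c a < x ! mem c b) l c) else None)"
| "exec x (Output p a) c =
     (if mem c a < length x
      then Some (c\<lparr>pc := Suc (pc c), written := (mem c p, x ! mem c a) # written c\<rparr>) else None)"
| "exec x Halt c = None"

definition step :: "instr list \<Rightarrow> 'a::linorder list \<Rightarrow> 'a config \<Rightarrow> 'a config option" where
  "step P x c = (if pc c < length P then exec x (P ! pc c) c else None)"

definition halted :: "instr list \<Rightarrow> 'a config \<Rightarrow> bool" where
  "halted P c \<longleftrightarrow> pc c < length P \<and> P ! pc c = Halt"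

text \<open>Initially cell 0 holds the length of the input and every other cell is 0.\<close>

definition init :: "'a list \<Rightarrow> 'a config" where
  "init x = \<lparr>pc = 0, mem = (\<lambda>_. 0)(0 := length x), written = []\<rparr>"

primrec run :: "instr list \<Rightarrow> 'a::linorder list \<Rightarrow> nat \<Rightarrow> 'a config option" where
  "run P x 0 = Some (init x)"
| "run P x (Suc t) = Option.bind (run P x t) (step P x)"

text \<open>
  The space of a configuration in bits. \<open>floorlog 2 k\<close> is the length of the binary representation
  of \<open>k\<close>. A nonzero cell is charged for its address as well as for its contents, so that no
  information can be hidden in the choice of the address; only finitely many cells are nonzero in a
  reachable configuration. The program counter is below \<open>length P\<close> whenever an instruction is
  executed and is not charged, as \<open>P\<close> does not depend on the input.
\<close>

definition space :: "'a config \<Rightarrow> nat" where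
  "space c = (\<Sum>a | mem c a \<noteq> 0. floorlog 2 a + floorlog 2 (mem c a))"

text \<open>
  On input \<open>x\<close>, program \<open>P\<close> halts after at most \<open>T\<close> steps, never uses more than \<open>S\<close> bits, and
  writes every entry of \<open>y\<close> to its place exactly once, in whatever order, and nothing else.
  Each instruction takes unit time; \<open>S\<close> also bounds the size of all numbers that occur in the
  memory.
\<close>

definition computes_within ::
    "instr list \<Rightarrow> 'a::linorder list \<Rightarrow> 'a list \<Rightarrow> nat \<Rightarrow> nat \<Rightarrow> bool" where
  "computes_within P x y T S \<longleftrightarrow>
     (\<exists>t c. t \<le> T \<and> run P x t = Some c \<and> halted P c \<and>
        mset (written c) = mset (List.enumerate 0 y) \<and>
        (\<forall>s\<le>t. \<forall>d. run P x s = Some d \<longrightarrow> space d \<le> S))"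

text \<open>
  \<open>sliding n t f x\<close> applies \<open>f\<close> to the first \<open>t\<close> windows of length \<open>n\<close> of \<open>x\<close>, which is meant
  to have length \<open>n + t - 1\<close>.
\<close>

definition sliding :: "nat \<Rightarrow> nat \<Rightarrow> ('a list \<Rightarrow> 'b) \<Rightarrow> 'a list \<Rightarrow> 'b list" where
  "sliding n t f x = map (\<lambda>i. f (take n (drop i x))) [0..<t]"

end

theory Submission
  imports Defs
begin

text \<open>
  Every window contains the middle symbol, so the window at \<open>i\<close> is the union of the left part
  \<open>{i..<n}\<close> and the right part \<open>{n - 1..n - 1 + i}\<close>. The left parts shrink and the right parts grow
  with \<open>i\<close>, so there is a threshold \<open>k\<close> such that the extremum comes from the left part for
  \<open>i < k\<close> and from the right part for \<open>i \<ge> k\<close>. Two pointers \<open>l\<close> and \<open>h\<close> moving towards each other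
  find \<open>k\<close>: if the extremum of the left part at \<open>h - 1\<close> beats that of the right part at \<open>l\<close>, then
  \<open>l < k\<close>; otherwise \<open>k \<le> h - 1\<close>. Afterwards \<open>l\<close> moves on upwards and \<open>h\<close> downwards, and each
  outputs its running extremum. This takes linear time and a constant number of cells.
\<close>

section \<open>Invariants, termination measures and space of program runs\<close>

lemma run_invariant:
  assumes "I (init x)"
    and "\<And>c d. I c \<Longrightarrow> step P x c = Some d \<Longrightarrow> I d"
    and "run P x t = Some c"
  shows "I c"
  using assms(3)
proof (induction t arbitrary: c)
  case 0
  with assms(1) show ?case by simp
next
  case (Suc t)
  then show ?case using assms(2) by (auto simp: bind_eq_Some_conv)
qed

lemma run_reaches_halt:
  fixes m :: "'a::linorder config \<Rightarrow> nat"
  assumes step: "\<And>c. I c \<Longrightarrow> \<not> halted P c \<Longrightarrow> \<exists>d. step P x c = Some d \<and> I d \<and> m d < m c"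
    and "I c" "run P x s = Some c"
  shows "\<exists>t d. t \<le> s + m c \<and> run P x t = Some d \<and> halted P d \<and> I d"
  using assms(2,3)
proof (induction "m c" arbitrary: c s rule: less_induct)
  case less
  show ?case
  proof (cases "halted P c")
    case True
    with less.prems show ?thesis by (intro exI[of _ s] exI[of _ c]) simp
  next
    case False
    with step less.prems obtain d where d: "step P x c = Some d" "I d" "m d < m c" by blast
    moreover from this less.prems have "run P x (Suc s) = Some d" by simp
    ultimately obtain t e where "t \<le> Suc s + m d" "run P x t = Some e" "halted P e" "I e"
      using less.hyps by blast
    with d show ?thesis by (intro exI[of _ t] exI[of _ e]) simp
  qed
qed

text \<open>Every step lowers the measure, so its initial value bounds the running time; the
  invariant yields both the output and the space bound.\<close>

lemma computes_withinI:
  fixes m :: "'a::linorder config \<Rightarrow> nat"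
  assumes init: "I (init x)"
    and step: "\<And>c. I c \<Longrightarrow> \<not> halted P c \<Longrightarrow> \<exists>d. step P x c = Some d \<and> I d \<and> m d < m c"
    and out: "\<And>c. I c \<Longrightarrow> halted P c \<Longrightarrow> mset (written c) = mset (List.enumerate 0 y)"
    and space: "\<And>c. I c \<Longrightarrow> space c \<le> S"
    and "m (init x) \<le> T"
  shows "computes_within P x y T S"
proof -
  obtain t c where "t \<le> 0 + m (init x)" "run P x t = Some c" "halted P c" "I c"
    using run_reaches_halt[where I = I and m = m, OF step init, of 0] by auto
  moreover have "I d" if "run P x s = Some d" for s d
  proof (rule run_invariant[where I = I, OF init _ that])
    fix c d assume c: "I c" "step P x c = Some d"
    \<comment> \<open>\<open>Halt\<close> has no successor configuration, so the existence of
      \<open>d\<close> rules it out.\<close>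
    then have "\<not> halted P c" by (auto simp: halted_def step_def)
    with step c show "I d" by fastforce
  qed
  ultimately show ?thesis
    using assms by (auto simp: computes_within_def intro!: exI[of _ t] exI[of _ c])
qed

text \<open>All nonzero cells have addresses below \<open>k\<close>, so the sum has at most
  \<open>k\<close> terms.\<close>

lemma space_le:
  assumes zero: "\<And>a. a \<ge> k \<Longrightarrow> mem c a = 0" and bound: "\<And>a. mem c a \<le> b"
  shows "space c \<le> k * (floorlog 2 k + floorlog 2 b)"
proof -
  have sub: "{a. mem c a \<noteq> 0} \<subseteq> {..<k}"
    using zero by (force simp: not_less[symmetric])
  have "space c \<le> (\<Sum>a | mem c a \<noteq> 0. floorlog 2 k + floorlog 2 b)"
    unfolding space_def using sub bound by (intro sum_mono add_mono floorlog_mono) auto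
  also have "\<dots> \<le> (\<Sum>a<k. floorlog 2 k + floorlog 2 b)"
    using sub by (intro sum_mono2) auto
  finally show ?thesis by simp
qed

section \<open>One program for maxima and minima, and its assertions\<close>

text \<open>The flag \<open>s\<close> selects minima instead of maxima.\<close>

definition beats :: "bool \<Rightarrow> 'a::linorder \<Rightarrow> 'a \<Rightarrow> bool" where
  "beats s u v \<longleftrightarrow> (if s then u < v else v < u)"

definition extremum :: "bool \<Rightarrow> 'a::linorder set \<Rightarrow> 'a" where
  "extremum s A = (if s then Min A else Max A)"

text \<open>Reversing the order amounts to swapping the operands of \<open>Compare\<close>, so one
  proof covers both extrema.\<close>

definition jump_if_beaten :: "bool \<Rightarrow> nat \<Rightarrow> nat \<Rightarrow> nat \<Rightarrow> instr" where
  "jump_if_beaten s a b l = (if s then Compare b a l else Compare a b l)"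

text \<open>
  Cell 1 holds \<open>n - 1\<close>, cell 4 the constant 1, cells 2 and 3 the pointers \<open>l\<close> and \<open>h\<close>, cells 5 and
  6 the positions of the extrema of the left and the right part read so far.
\<close>

definition window_program :: "bool \<Rightarrow> instr list" where
  "window_program s =
    [Const 4 1,
     Half 1 0,
     Add 3 1 4,
     Copy 5 1,
     Copy 6 1,
     \<comment> \<open>5: search for the threshold\<close>
     Sub 7 3 4,
     jump_if_beaten s 7 5 8,
     Copy 5 7,
     Add 7 1 2,
     jump_if_beaten s 7 6 11,
     Copy 6 7,
     jump_if_beaten s 6 5 14,
     Sub 3 3 4,
     Jump 15,
     Add 2 2 4,
     JumpLess 2 3 5,
     \<comment> \<open>16: output the extrema of the right parts\<close>
     JumpLess 1 2 23,
     Add 7 1 2,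
     jump_if_beaten s 7 6 20,
     Copy 6 7,
     Output 2 6,
     Add 2 2 4,
     Jump 16,
     \<comment> \<open>23: output the extrema of the left parts\<close>
     JumpLess 3 4 29,
     Sub 3 3 4,
     jump_if_beaten s 3 5 27,
     Copy 5 3,
     Output 3 5,
     Jump 23,
     Halt]"

definition unbeaten :: "bool \<Rightarrow> 'a::linorder list \<Rightarrow> nat \<Rightarrow> nat set \<Rightarrow> bool" where
  "unbeaten s x a A \<longleftrightarrow> (\<forall>k\<in>A. \<not> beats s (x ! k) (x ! a))"

text \<open>A tie counts for both parts, so \<open>left_wins\<close> and \<open>right_wins\<close>
  may hold together.\<close>

definition left_wins :: "bool \<Rightarrow> 'a::linorder list \<Rightarrow> nat \<Rightarrow> nat \<Rightarrow> bool" where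
  "left_wins s x n i \<longleftrightarrow> (\<exists>j\<in>{i..<n}. unbeaten s x j {n - 1..n - 1 + i})"

definition right_wins :: "bool \<Rightarrow> 'a::linorder list \<Rightarrow> nat \<Rightarrow> nat \<Rightarrow> bool" where
  "right_wins s x n i \<longleftrightarrow> (\<exists>j\<in>{n - 1..n - 1 + i}. unbeaten s x j {i..<n})"

text \<open>The bound \<open>h - 1 \<le> a\<close> admits the position that is fetched before the
  pointer moves, and the start \<open>h = n\<close>, \<open>a = n - 1\<close> with nothing read
  yet.\<close>

definition left_best :: "bool \<Rightarrow> 'a::linorder list \<Rightarrow> nat \<Rightarrow> nat \<Rightarrow> nat \<Rightarrow> bool" where
  "left_best s x n h a \<longleftrightarrow> h \<le> n \<and> h - 1 \<le> a \<and> a < n \<and> unbeaten s x a {h..<n}"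

definition right_best :: "bool \<Rightarrow> 'a::linorder list \<Rightarrow> nat \<Rightarrow> nat \<Rightarrow> nat \<Rightarrow> bool" where
  "right_best s x n l b \<longleftrightarrow>
     n - 1 \<le> b \<and> b \<le> n - 1 + l \<and> unbeaten s x b {n - 1..<n - 1 + l}"

text \<open>A threshold lies between \<open>l\<close> and \<open>h\<close>; once they meet, every
  window is assigned to a part.\<close>

definition decided :: "bool \<Rightarrow> 'a::linorder list \<Rightarrow> nat \<Rightarrow> nat \<Rightarrow> nat \<Rightarrow> bool" where
  "decided s x n l h \<longleftrightarrow> (\<forall>i<l. left_wins s x n i) \<and> (\<forall>i\<in>{h..<n}. right_wins s x n i)"

text \<open>Multisets hide the order of output: right parts upwards first, then left parts
  downwards.\<close>

definition emitted ::
    "bool \<Rightarrow> 'a::linorder list \<Rightarrow> nat \<Rightarrow> nat set \<Rightarrow> (nat \<times> 'a) list \<Rightarrow> bool" where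
  "emitted s x n A w \<longleftrightarrow>
     mset w = image_mset (\<lambda>i. (i, extremum s ((!) x ` {i..<i + n}))) (mset_set A)"

section \<open>Window extrema from the two parts\<close>

lemma beats_not_trans: "\<not> beats s u v \<Longrightarrow> \<not> beats s v w \<Longrightarrow> \<not> beats s u w"
  by (auto simp: beats_def split: if_splits)

lemma beats_irrefl [simp]: "\<not> beats s u u"
  by (simp add: beats_def)

lemma beats_asym: "beats s u v \<Longrightarrow> \<not> beats s v u"
  by (auto simp: beats_def split: if_splits)

lemma unbeatenD: "unbeaten s x a A \<Longrightarrow> k \<in> A \<Longrightarrow> \<not> beats s (x ! k) (x ! a)"
  by (simp add: unbeaten_def)

lemma unbeaten_replace:
  "unbeaten s x a A \<Longrightarrow> \<not> beats s (x ! a) (x ! p) \<Longrightarrow> unbeaten s x p A"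
  unfolding unbeaten_def using beats_not_trans by blast

lemma extremum_eqI:
  assumes "finite A" "a \<in> A" "unbeaten s x a A"
  shows "extremum s ((!) x ` A) = x ! a"
  using assms by (auto simp: extremum_def unbeaten_def beats_def intro!: Min_eqI Max_eqI)

lemma window_split:
  assumes "i < n" shows "{i..<i + n} = {i..<n} \<union> {n - 1..n - 1 + (i::nat)}"
  using assms by auto

text \<open>Some \<open>j\<close> on the left is unbeaten on the right; \<open>a\<close> is not
  beaten by \<open>j\<close>, so it inherits this by transitivity.\<close>

lemma extremum_left:
  assumes "left_wins s x n i" "i \<le> a" "a < n" "unbeaten s x a {i..<n}"
  shows "extremum s ((!) x ` {i..<i + n}) = x ! a"
proof (rule extremum_eqI)
  obtain j where "j \<in> {i..<n}" "unbeaten s x j {n - 1..n - 1 + i}"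
    using assms(1) by (auto simp: left_wins_def)
  with assms(4) have "unbeaten s x a {n - 1..n - 1 + i}"
    by (blast intro: unbeaten_replace dest: unbeatenD)
  then have "unbeaten s x a ({i..<n} \<union> {n - 1..n - 1 + i})"
    using assms(4) by (auto simp: unbeaten_def)
  then show "unbeaten s x a {i..<i + n}"
    using assms window_split[of i n] by simp
qed (use assms in auto)

lemma extremum_right:
  assumes "right_wins s x n i" "i < n" "n - 1 \<le> b" "b \<le> n - 1 + i"
    "unbeaten s x b {n - 1..n - 1 + i}"
  shows "extremum s ((!) x ` {i..<i + n}) = x ! b"
proof (rule extremum_eqI)
  obtain j where "j \<in> {n - 1..n - 1 + i}" "unbeaten s x j {i..<n}"
    using assms(1) by (auto simp: right_wins_def)
  with assms(5) have "unbeaten s x b {i..<n}"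
    by (blast intro: unbeaten_replace dest: unbeatenD)
  then have "unbeaten s x b ({i..<n} \<union> {n - 1..n - 1 + i})"
    using assms(5) by (auto simp: unbeaten_def)
  then show "unbeaten s x b {i..<i + n}"
    using assms window_split[of i n] by simp
qed (use assms in auto)

section \<open>Verification conditions for moving pointers and output\<close>

lemma unbeaten_left_keep:
  assumes "left_best s x n (Suc h) a" "\<not> beats s (x ! h) (x ! a)"
  shows "unbeaten s x a {h..<n}"
  using assms unfolding left_best_def unbeaten_def
  by (metis atLeastLessThan_iff le_neq_implies_less Suc_leI)

lemma unbeaten_left_replace:
  assumes "left_best s x n (Suc h) a" "\<not> beats s (x ! a) (x ! h)"
  shows "unbeaten s x h {h..<n}"
proof -
  have "unbeaten s x h {Suc h..<n}"
    using assms unbeaten_replace by (auto simp: left_best_def)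
  moreover have "{h..<n} = insert h {Suc h..<n}"
    using assms by (auto simp: left_best_def)
  ultimately show ?thesis by (simp add: unbeaten_def)
qed

lemma unbeaten_right_keep:
  assumes "right_best s x n l b" "\<not> beats s (x ! (n - 1 + l)) (x ! b)"
  shows "unbeaten s x b {n - 1..n - 1 + l}"
  using assms unfolding right_best_def unbeaten_def
  by (metis atLeastLessThan_iff atLeastAtMost_iff le_neq_implies_less)

lemma unbeaten_right_replace:
  assumes "right_best s x n l b" "\<not> beats s (x ! b) (x ! (n - 1 + l))"
  shows "unbeaten s x (n - 1 + l) {n - 1..n - 1 + l}"
proof -
  have "unbeaten s x (n - 1 + l) {n - 1..<n - 1 + l}"
    using assms unbeaten_replace by (auto simp: right_best_def)
  moreover have "{n - 1..n - 1 + l} = insert (n - 1 + l) {n - 1..<n - 1 + l}"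
    by auto
  ultimately show ?thesis by (simp add: unbeaten_def)
qed

lemma left_best_replace:
  "left_best s x n (Suc h) a \<Longrightarrow> \<not> beats s (x ! a) (x ! h) \<Longrightarrow> left_best s x n (Suc h) h"
  using unbeaten_replace by (auto simp: left_best_def)

lemma right_best_replace:
  "right_best s x n l b \<Longrightarrow> \<not> beats s (x ! b) (x ! (n - 1 + l)) \<Longrightarrow>
    right_best s x n l (n - 1 + l)"
  using unbeaten_replace by (auto simp: right_best_def)

lemma left_best_mono:
  "left_best s x n (Suc h) a \<Longrightarrow> unbeaten s x a {h..<n} \<Longrightarrow> left_best s x n h a"
  by (auto simp: left_best_def)

lemma right_best_Suc:
  "right_best s x n l b \<Longrightarrow> unbeaten s x b {n - 1..n - 1 + l} \<Longrightarrow> right_best s x n (Suc l) b"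
  by (auto simp: right_best_def unbeaten_def)

text \<open>From \<open>l \<le> h - 1 \<le> a\<close> the position \<open>a\<close> lies in the left
  part of window \<open>l\<close>, and it beats the best of the right part.\<close>

lemma decided_Suc_left:
  assumes "decided s x n l h" "l < h" "left_best s x n h a"
    "unbeaten s x b {n - 1..n - 1 + l}" "beats s (x ! a) (x ! b)"
  shows "decided s x n (Suc l) h"
proof -
  have "left_wins s x n l"
    unfolding left_wins_def
  proof (rule bexI[of _ a])
    show "unbeaten s x a {n - 1..n - 1 + l}"
      using assms(4) beats_asym[OF assms(5)] by (rule unbeaten_replace)
  qed (use assms in \<open>auto simp: left_best_def\<close>)
  then show ?thesis
    using assms(1) by (auto simp: decided_def less_Suc_eq)
qed

text \<open>Here \<open>Suc h\<close> is the pointer. From \<open>l \<le> h\<close> the position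
  \<open>b\<close> lies in the right part of window \<open>h\<close>; ties go to the right.\<close>

lemma decided_right:
  assumes "decided s x n l (Suc h)" "l < Suc h" "right_best s x n l b"
    "unbeaten s x a {h..<n}" "\<not> beats s (x ! a) (x ! b)"
  shows "decided s x n l h"
proof -
  have "right_wins s x n h"
    unfolding right_wins_def
  proof (rule bexI[of _ b])
    show "unbeaten s x b {h..<n}"
      using assms(4,5) by (rule unbeaten_replace)
  qed (use assms in \<open>auto simp: right_best_def\<close>)
  then show ?thesis
    using assms(1) unfolding decided_def
    by (metis atLeastLessThan_iff le_neq_implies_less Suc_leI)
qed

lemma decided_mono: "decided s x n l h \<Longrightarrow> k \<le> l \<Longrightarrow> h \<le> j \<Longrightarrow> decided s x n k j"
  by (auto simp: decided_def)

lemma invariants_initially: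
  shows "left_best s x (Suc m) (Suc m) m" and "right_best s x (Suc m) 0 m"
    and "decided s x n 0 n" and "emitted s x n {} []"
  by (auto simp: left_best_def right_best_def unbeaten_def decided_def emitted_def)

lemma emitted_insert:
  assumes "emitted s x n A w" "finite A" "i \<notin> A" "extremum s ((!) x ` {i..<i + n}) = v"
  shows "emitted s x n (insert i A) ((i, v) # w)"
  using assms by (simp add: emitted_def)

text \<open>When a loop ends, \<open>l = n\<close> is known only by arithmetic; as a separate
  premise it can go to \<open>linarith\<close>.\<close>

lemma emitted_cong: "emitted s x n {h..<l} w \<Longrightarrow> l = k \<Longrightarrow> emitted s x n {h..<k} w"
  by simp

lemma emitted_left:
  assumes "emitted s x n {Suc h..<n} w" "decided s x n (Suc h) n"
    "left_best s x n (Suc h) a" "unbeaten s x a {h..<n}"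
  shows "emitted s x n {h..<n} ((h, x ! a) # w)"
proof -
  have "extremum s ((!) x ` {h..<h + n}) = x ! a"
    using assms by (intro extremum_left) (auto simp: decided_def left_best_def)
  moreover have "{h..<n} = insert h {Suc h..<n}"
    using assms by (auto simp: left_best_def)
  ultimately show ?thesis
    using emitted_insert[OF assms(1)] by simp
qed

lemma emitted_right:
  assumes "emitted s x n {h..<l} w" "decided s x n h h" "h \<le> l" "l < n"
    "right_best s x n l b" "unbeaten s x b {n - 1..n - 1 + l}"
  shows "emitted s x n {h..<Suc l} ((l, x ! b) # w)"
proof -
  have "extremum s ((!) x ` {l..<l + n}) = x ! b"
    using assms by (intro extremum_right) (auto simp: decided_def right_best_def)
  moreover have "{h..<Suc l} = insert l {h..<l}"
    using assms by auto
  ultimately show ?thesis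
    using emitted_insert[OF assms(1)] by simp
qed

lemma emitted_all:
  assumes "length x = 2 * n - 1" "emitted s x n {0..<n} w"
  shows "mset w = mset (List.enumerate 0 (sliding n n (\<lambda>a. extremum s (set a)) x))"
proof -
  let ?y = "sliding n n (\<lambda>a. extremum s (set a)) x"
  \<comment> \<open>The length of \<open>x\<close> gives \<open>i + n \<le> length x\<close>, so no
    window is cut short.\<close>
  have window: "set (take n (drop i x)) = (!) x ` {i..<i + n}" if "i < n" for i
  proof -
    have "take n (drop i x) = map ((!) x) [i..<i + n]"
      using that assms(1) by (intro nth_equalityI) auto
    then show ?thesis by simp
  qed
  have "List.enumerate 0 ?y = map (\<lambda>i. (i, extremum s ((!) x ` {i..<i + n}))) [0..<n]"
    by (rule nth_equalityI) (auto simp: sliding_def nth_enumerate_eq window)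
  then show ?thesis
    using assms(2) by (simp add: emitted_def)
qed

section \<open>Correctness of the program\<close>

text \<open>One assertion per program location. At 13 and 15 the pointers may have met; at 21 window
  \<open>l\<close> is output but \<open>l\<close> not yet advanced; from 25 to 27 \<open>h\<close>
  has moved but its window is not yet output.\<close>

definition window_inv :: "bool \<Rightarrow> 'a::linorder list \<Rightarrow> nat \<Rightarrow> 'a config \<Rightarrow> bool" where
  "window_inv s x n c \<longleftrightarrow>
    (let i = pc c; q = mem c; w = written c; l = q 2; h = q 3; a = q 5; b = q 6; p = q 7 in
     i < 30 \<and> q 0 = 2 * n - 1 \<and> (\<forall>j\<ge>8. q j = 0) \<and> (\<forall>j. q j \<le> 2 * n) \<and>
     (1 \<le> i \<longrightarrow> q 4 = 1) \<and> (2 \<le> i \<longrightarrow> q 1 = n - 1) \<and>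
     (i < 5 \<longrightarrow> l = 0 \<and> (3 \<le> i \<longrightarrow> h = n) \<and> (4 \<le> i \<longrightarrow> a = n - 1)) \<and>
     (i < 16 \<longrightarrow> w = []) \<and>
     (5 \<le> i \<and> i < 16 \<longrightarrow> l \<le> h \<and> decided s x n l h) \<and>
     (5 \<le> i \<and> i < 16 \<and> i \<noteq> 13 \<and> i \<noteq> 15 \<longrightarrow> l < h) \<and>
     (5 \<le> i \<and> i < 25 \<or> i = 28 \<longrightarrow> left_best s x n h a) \<and>
     (5 \<le> i \<and> i < 23 \<longrightarrow> right_best s x n l b) \<and>
     (i = 6 \<or> i = 7 \<longrightarrow> p = h - 1) \<and>
     (i = 7 \<longrightarrow> \<not> beats s (x ! a) (x ! (h - 1))) \<and>
     (8 \<le> i \<and> i < 13 \<or> i = 14 \<longrightarrow> unbeaten s x a {h - 1..<n}) \<and>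
     (i = 9 \<or> i = 10 \<or> i = 18 \<or> i = 19 \<longrightarrow> p = n - 1 + l) \<and>
     (i = 10 \<or> i = 19 \<longrightarrow> \<not> beats s (x ! b) (x ! (n - 1 + l))) \<and>
     (i = 11 \<or> i = 12 \<or> i = 14 \<or> i = 20 \<or> i = 21 \<longrightarrow> unbeaten s x b {n - 1..n - 1 + l}) \<and>
     (i = 12 \<longrightarrow> \<not> beats s (x ! a) (x ! b)) \<and>
     (i = 14 \<longrightarrow> beats s (x ! a) (x ! b)) \<and>
     (16 \<le> i \<and> i < 23 \<longrightarrow> h \<le> l \<and> l \<le> n \<and> decided s x n h h) \<and>
     (17 \<le> i \<and> i < 22 \<longrightarrow> l < n) \<and>
     (16 \<le> i \<and> i < 23 \<longrightarrow> emitted s x n {h..<(if i = 21 then Suc l else l)} w) \<and>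
     (i = 23 \<or> i = 24 \<or> i = 28 \<longrightarrow> decided s x n h n \<and> emitted s x n {h..<n} w) \<and>
     (i = 24 \<longrightarrow> 0 < h) \<and>
     (25 \<le> i \<and> i < 28 \<longrightarrow>
        left_best s x n (Suc h) a \<and> decided s x n (Suc h) n \<and> emitted s x n {Suc h..<n} w) \<and>
     (i = 26 \<longrightarrow> \<not> beats s (x ! a) (x ! h)) \<and>
     (i = 27 \<longrightarrow> unbeaten s x a {h..<n}) \<and>
     (i = 29 \<longrightarrow> emitted s x n {0..<n} w))"

text \<open>
  The offsets decrease along the program, except just after a pointer has moved, where the drop of
  the other terms makes up for the increase.
\<close>

definition window_measure :: "nat \<Rightarrow> 'a config \<Rightarrow> nat" where
  "window_measure n c =
    (if pc c < 5 then 40 * n + 24 - pc c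
     else 20 * (mem c 3 - mem c 2) + 10 * (n - mem c 2) + 10 * mem c 3 +
       [0, 0, 0, 0, 0, 19, 18, 17, 16, 15, 14, 13, 12, 21, 12, 20,
        8, 7, 6, 5, 4, 3, 10, 2, 1, 8, 7, 6, 5, 0] ! pc c)"

lemma length_window_program [simp]: "length (window_program s) = 30"
  by (simp add: window_program_def)

lemma exec_jump_if_beaten [simp]:
  "exec x (jump_if_beaten s a b l) c =
    (if mem c a < length x \<and> mem c b < length x
     then Some (branch (beats s (x ! mem c b) (x ! mem c a)) l c) else None)"
  by (auto simp: jump_if_beaten_def beats_def)

lemma jump_if_beaten_neq_Halt [simp]: "jump_if_beaten s a b l \<noteq> Halt"
  by (simp add: jump_if_beaten_def)

lemma less_30_cases:
  "i < (30::nat) \<Longrightarrow>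
    i \<in> {0,1,2,3,4,5,6,7,8,9,10,11,12,13,14,
         15,16,17,18,19,20,21,22,23,24,25,26,27,28,29}"
  by (simp only: insert_iff empty_iff) arith

lemma window_step:
  assumes n: "1 \<le> n" "length x = 2 * n - 1"
    and inv: "window_inv s x n c" and run: "\<not> halted (window_program s) c"
  shows "\<exists>d. step (window_program s) x c = Some d \<and> window_inv s x n d \<and>
             window_measure n d < window_measure n c"
proof -
  obtain i q w where c: "c = \<lparr>pc = i, mem = q, written = w\<rparr>" by (cases c) auto
  obtain m where m: "n = Suc m" using n(1) by (cases n) auto
  have left: "left_best s x n h a \<Longrightarrow> h \<le> n \<and> h - 1 \<le> a \<and> a < n" for h a
    by (simp add: left_best_def)
  have right: "right_best s x n l b \<Longrightarrow> n - 1 \<le> b \<and> b \<le> n - 1 + l" for l b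
    by (simp add: right_best_def)
  \<comment> \<open>These keep the compared and output positions in range; the instance at
    \<open>Suc (q 3)\<close> serves locations 25 to 27.\<close>
  note bounds = left[of "q 3" "q 5"] left[of "Suc (q 3)" "q 5"] right[of "q 2" "q 6"]
  note vc = invariants_initially unbeaten_left_keep unbeaten_left_replace left_best_replace
    left_best_mono decided_right emitted_left
  note vc_Suc = unbeaten_right_keep unbeaten_right_replace right_best_replace right_best_Suc
    decided_Suc_left emitted_right
  \<comment> \<open>With \<open>n = Suc m\<close> the goals contain \<open>m\<close> for
    \<open>n - 1\<close>; the rules must match that form.\<close>
  note vcs = vc vc_Suc[where n = "Suc m", simplified]
  have "i < 30" using inv by (simp add: window_inv_def c Let_def)
  note pc_cases = less_30_cases[OF this]
  show ?thesis
    \<comment> \<open>Symbolic execution of each location. Splitting \<open>q 3\<close> exposes the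
      \<open>Suc h\<close> in the rules for the left pointer.\<close>
    by (insert pc_cases inv n run bounds; elim insertE emptyE; cases "q 3";
        (simp add: c m step_def window_program_def set_cell_def branch_def window_inv_def
          window_measure_def Let_def halted_def);
        (elim conjE)?; (intro conjI impI)?;
        (assumption
          | (rule vcs; (assumption | erule beats_asym | rule le0))
          | (rule decided_mono, assumption, linarith, linarith)
          | (rule emitted_cong, assumption, linarith)
          | linarith | simp))
qed

lemma window_halted:
  assumes n: "length x = 2 * n - 1"
    and inv: "window_inv s x n c" and halted: "halted (window_program s) c"
  shows "mset (written c) = mset (List.enumerate 0 (sliding n n (\<lambda>a. extremum s (set a)) x))"
proof -
  have "pc c < 30" using inv by (simp add: window_inv_def Let_def)
  from less_30_cases[OF this] have "pc c = 29"
    using halted by (elim insertE emptyE) (simp_all add: halted_def window_program_def)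
  then have "emitted s x n {0..<n} (written c)"
    using inv by (simp add: window_inv_def Let_def)
  with n show ?thesis by (rule emitted_all)
qed

lemma window_program_computes:
  assumes "1 \<le> n" "length x = 2 * n - 1"
  shows "computes_within (window_program s) x (sliding n n (\<lambda>a. extremum s (set a)) x)
    (40 * n + 24) (8 * (floorlog 2 8 + floorlog 2 (2 * n)))"
proof (rule computes_withinI[where I = "window_inv s x n" and m = "window_measure n"])
  show "window_inv s x n (init x)"
    using assms by (simp add: window_inv_def init_def)
  \<comment> \<open>The search starts with \<open>l = 0\<close>, \<open>h = n\<close> at measure
    \<open>40 * n + 19\<close>; five set-up instructions precede it.\<close>
  show "window_measure n (init x) \<le> 40 * n + 24"
    by (simp add: window_measure_def init_def)
  show "space c \<le> 8 * (floorlog 2 8 + floorlog 2 (2 * n))" if "window_inv s x n c" for c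
    using that by (intro space_le) (auto simp: window_inv_def Let_def)
qed (use assms in \<open>auto intro: window_step window_halted\<close>)

section \<open>Asymptotic bounds\<close>

lemma eventually_ln_ge_1: "eventually (\<lambda>n. 1 \<le> ln (real n)) sequentially"
  using filterlim_compose[OF ln_at_top filterlim_real_sequentially]
  by (auto simp: filterlim_at_top)

lemma window_time_bound: "(\<lambda>n. real (40 * n + 24)) \<in> O(\<lambda>n. real n * ln (real n))"
\<comment> \<open>\<open>64 = 40 + 24\<close>, as both \<open>n\<close> and \<open>ln n\<close> are
  eventually at least 1.\<close>
proof (rule bigoI[of _ 64])
  show "\<forall>\<^sub>F n in sequentially. norm (real (40 * n + 24)) \<le> 64 * norm (real n * ln (real n))"
    using eventually_ln_ge_1 eventually_ge_at_top[of 1]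
  proof eventually_elim
    case (elim n)
    then have "real n \<le> real n * ln (real n)" by simp
    then have "40 * real n + 24 \<le> 64 * (real n * ln (real n))"
      using elim(2) by linarith
    with elim show ?case by simp
  qed
qed

lemma window_space_bound:
  "(\<lambda>n. real (8 * (floorlog 2 8 + floorlog 2 (2 * n)))) \<in> O(\<lambda>n. ln (real n))"
\<comment> \<open>From \<open>floorlog 2 (2 * n) \<le> 2 + ln n / ln 2\<close>, with the constants
  absorbed by \<open>ln n \<ge> 1\<close>.\<close>
proof (rule bigoI[of _ "8 * (floorlog 2 8 + 2 + 1 / ln 2)"])
  show "\<forall>\<^sub>F n in sequentially. norm (real (8 * (floorlog 2 8 + floorlog 2 (2 * n))))
      \<le> 8 * (floorlog 2 8 + 2 + 1 / ln 2) * norm (ln (real n))"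
    using eventually_ln_ge_1 eventually_ge_at_top[of 1]
  proof eventually_elim
    case (elim n)
    have "real (floorlog 2 (2 * n)) = real_of_int \<lfloor>log 2 (real (2 * n))\<rfloor> + 1"
      using elim by (simp add: floorlog_def)
    also have "\<dots> \<le> log 2 (real (2 * n)) + 1" by linarith
    also have "log 2 (real (2 * n)) = 1 + ln (real n) / ln 2"
      using elim by (simp add: log_mult) (simp add: log_def)
    finally have "real (floorlog 2 (2 * n)) \<le> 2 + ln (real n) / ln 2" by simp
    moreover have "real (floorlog 2 8) + 2 \<le> (real (floorlog 2 8) + 2) * ln (real n)"
      using elim mult_left_mono[of 1 "ln (real n)" "real (floorlog 2 8) + 2"] by simp
    ultimately have "real (floorlog 2 8) + real (floorlog 2 (2 * n))
        \<le> (real (floorlog 2 8) + 2) * ln (real n) + ln (real n) / ln 2"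
      by argo
    then show ?case
      using elim by (simp add: distrib_right)
  qed
qed

theorem theorem4p1:
  shows
    "(\<exists>(P :: instr list) (T :: nat \<Rightarrow> nat) (S :: nat \<Rightarrow> nat).
        (\<lambda>n. real (T n)) \<in> O(\<lambda>n. real n * ln (real n)) \<and>
        (\<lambda>n. real (S n)) \<in> O(\<lambda>n. ln (real n)) \<and>
        (\<forall>n\<ge>1. \<forall>x :: 'a::linorder list. length x = 2 * n - 1 \<longrightarrow>
           computes_within P x (sliding n n (\<lambda>a. Max (set a)) x) (T n) (S n))) \<and>
     (\<exists>(P :: instr list) (T :: nat \<Rightarrow> nat) (S :: nat \<Rightarrow> nat).
        (\<lambda>n. real (T n)) \<in> O(\<lambda>n. real n * ln (real n)) \<and>
        (\<lambda>n. real (S n)) \<in> O(\<lambda>n. ln (real n)) \<and>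
        (\<forall>n\<ge>1. \<forall>x :: 'a::linorder list. length x = 2 * n - 1 \<longrightarrow>
           computes_within P x (sliding n n (\<lambda>a. Min (set a)) x) (T n) (S n)))"
\<comment> \<open>The witnesses stay schematic until the two \<open>show\<close> statements fix
  them.\<close>
proof (intro conjI exI allI impI)
  show "computes_within (window_program False) x (sliding n n (\<lambda>a. Max (set a)) x)
      (40 * n + 24) (8 * (floorlog 2 8 + floorlog 2 (2 * n)))"
    if "1 \<le> n" "length x = 2 * n - 1" for n and x :: "'a list"
    using window_program_computes[OF that, of False] by (simp add: extremum_def)
  show "computes_within (window_program True) x (sliding n n (\<lambda>a. Min (set a)) x)
      (40 * n + 24) (8 * (floorlog 2 8 + floorlog 2 (2 * n)))"
    if "1 \<le> n" "length x = 2 * n - 1" for n and x :: "'a list"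
    using window_program_computes[OF that, of True] by (simp add: extremum_def)
qed (fact window_time_bound window_space_bound)+

end
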